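(* Let $(H;(\cdot,\cdot))$ be an inner product space over $\mathbb{K}$, where $\mathbb{K}=\mathbb{R}$ or $\mathbb{K}=\mathbb{C}$, let $n\ge1$, let $x,y_1,\dots,y_n\in H$, and let $p,q$ be real numbers with $p>1$ and $\frac1p+\frac1q=1$. Then $$\sum_{i=1}^n|(x,y_i)|^2\le\|x\|\Big(\sum_{i=1}^n|(x,y_i)|^{2p}\Big)^{\frac1{2p}}\Big\{\Big(\sum_{i=1}^n\|y_i\|^{2q}\Big)^{\frac1q}+(n-1)^{\frac1p}\Big(\sum_{1\le i\ne j\le n}|(y_i,y_j)|^q\Big)^{\frac1q}\Big\}^{\frac12}.$$
   Context: Here $\|v\|=(v,v)^{1/2}$. The sum over $1\le i\ne j\le n$ ranges over all ordered pairs $(i,j)\in\{1,\dots,n\}^2$ with $i\neq j$ (an empty sum is $0$). *)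

theory Defs
  imports "HOL-Analysis.Analysis"
begin

text \<open>
  Real inner product spaces are the library class \<open>real_inner\<close>. The class below is its complex
  counterpart; the inner product is linear in its first argument and hence conjugate-linear
  in the second.
\<close>

class complex_inner = ab_group_add +
  fixes scaleC :: "complex \<Rightarrow> 'a \<Rightarrow> 'a"
    and cinner :: "'a \<Rightarrow> 'a \<Rightarrow> complex"
  assumes scaleC_add_right: "scaleC a (x + y) = scaleC a x + scaleC a y"
    and scaleC_add_left: "scaleC (a + b) x = scaleC a x + scaleC b x"
    and scaleC_scaleC: "scaleC a (scaleC b x) = scaleC (a * b) x"
    and scaleC_one: "scaleC 1 x = x"
    and cinner_add_left: "cinner (x + y) z = cinner x z + cinner y z"
    and cinner_scaleC_left: "cinner (scaleC a x) y = a * cinner x y"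
    and cinner_commute: "cinner x y = cnj (cinner y x)"
    \<comment> \<open>\<open>cinner x x\<close> is real by \<open>cinner_commute\<close>\<close>
    and cinner_ge_zero: "0 \<le> Re (cinner x x)"
    and cinner_eq_zero_iff: "cinner x x = 0 \<longleftrightarrow> x = 0"
begin

definition cnorm :: "'a \<Rightarrow> real"
  where "cnorm x = sqrt (Re (cinner x x))"

end

instantiation complex :: complex_inner
begin

definition scaleC_complex :: "complex \<Rightarrow> complex \<Rightarrow> complex"
  where "scaleC_complex a x = a * x"

definition cinner_complex :: "complex \<Rightarrow> complex \<Rightarrow> complex"
  where "cinner_complex x y = x * cnj y"

instance
  by standard
    (auto simp: scaleC_complex_def cinner_complex_def algebra_simps)

end

lemma cnorm_complex: "cnorm (z :: complex) = cmod z"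
  by (simp add: cnorm_def cinner_complex_def cmod_def power2_eq_square)

end

theory Submission imports Defs begin

text \<open>
  Put \<open>c\<^sub>i = (x, y\<^sub>i)\<close>, \<open>a\<^sub>i = |c\<^sub>i|\<close> and \<open>w = \<Sum> c\<^sub>i y\<^sub>i\<close>. Then \<open>\<Sum> a\<^sub>i\<^sup>2 = (x, w)\<close>, so the
  Cauchy--Schwarz inequality bounds the left-hand side by \<open>\<parallel>x\<parallel> \<parallel>w\<parallel>\<close>, and expanding \<open>\<parallel>w\<parallel>\<^sup>2\<close> leaves
  the real double sum \<open>\<Sum> a\<^sub>i a\<^sub>j |(y\<^sub>i, y\<^sub>j)|\<close> to be estimated. From there on the scalar field no
  longer matters.

  The double sum is split into its diagonal and its off-diagonal part, and Hoelder's inequality is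
  applied to each of them separately (\<open>quadratic_sum_le\<close>). The diagonal part yields
  \<open>(\<Sum> a\<^sub>i\<^bsup>2p\<^esup>)\<^bsup>1/p\<^esup>\<close> at once. The off-diagonal part yields
  \<open>(\<Sum>\<^bsub>i\<noteq>j\<^esub> a\<^sub>i\<^sup>p a\<^sub>j\<^sup>p)\<^bsup>1/p\<^esup>\<close>, and \<open>\<Sum>\<^bsub>i\<noteq>j\<^esub> a\<^sub>i\<^sup>p a\<^sub>j\<^sup>p \<le> (n - 1) \<Sum> a\<^sub>i\<^bsup>2p\<^esup>\<close>
  (\<open>sum_off_diagonal_mult_le\<close>), which is the source of the factor \<open>(n - 1)\<^bsup>1/p\<^esup>\<close>. Factoring out
  \<open>(\<Sum> a\<^sub>i\<^bsup>2p\<^esup>)\<^bsup>1/p\<^esup>\<close> and taking square roots gives the claim.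
\<close>

section \<open>Hoelder's inequality and double sums\<close>

text \<open>
  After normalising both factors to norm one, this is Young's inequality summed over the
  index set.
\<close>

lemma Holder_inequality_sum:
  fixes f g :: "'i \<Rightarrow> real"
  assumes fin: "finite A" and pq: "p > 1" "q > 1" "1 / p + 1 / q = 1"
    and f: "\<And>i. i \<in> A \<Longrightarrow> f i \<ge> 0" and g: "\<And>i. i \<in> A \<Longrightarrow> g i \<ge> 0"
  shows "(\<Sum>i\<in>A. f i * g i)
    \<le> (\<Sum>i\<in>A. f i powr p) powr (1 / p) * (\<Sum>i\<in>A. g i powr q) powr (1 / q)"
proof -
  define F where "F = (\<Sum>i\<in>A. f i powr p)"
  define G where "G = (\<Sum>i\<in>A. g i powr q)"
  have FG: "F \<ge> 0" "G \<ge> 0"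
    by (auto simp: F_def G_def intro!: sum_nonneg)
  show ?thesis
  proof (cases "F = 0 \<or> G = 0")
    case True
    then have "(\<forall>i\<in>A. f i = 0) \<or> (\<forall>i\<in>A. g i = 0)"
      using fin by (auto simp: F_def G_def sum_nonneg_eq_0_iff)
    then have "(\<Sum>i\<in>A. f i * g i) = 0"
      by (auto intro!: sum.neutral)
    then show ?thesis
      by simp
  next
    case False
    with FG have pos: "F > 0" "G > 0"
      by auto
    define s where "s = F powr (1 / p)"
    define t where "t = G powr (1 / q)"
    have st: "s > 0" "t > 0" "s powr p = F" "t powr q = G"
      using pos pq by (auto simp: s_def t_def powr_powr)
    have "(\<Sum>i\<in>A. f i * g i) / (s * t) = (\<Sum>i\<in>A. (f i / s) * (g i / t))"
      by (simp add: sum_divide_distrib)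
    also have "\<dots> \<le> (\<Sum>i\<in>A. (f i / s) powr p / p + (g i / t) powr q / q)"
      using st f g by (intro sum_mono Youngs_inequality pq) (auto intro!: divide_nonneg_pos)
    also have "\<dots> = (\<Sum>i\<in>A. f i powr p / F / p + g i powr q / G / q)"
      using st f g by (intro sum.cong) (auto simp: powr_divide)
    also have "\<dots> = 1 / p + 1 / q"
      using pos by (simp add: sum.distrib F_def G_def flip: sum_divide_distrib)
    finally have "(\<Sum>i\<in>A. f i * g i) / (s * t) \<le> 1"
      using pq by simp
    then show ?thesis
      using st by (simp add: divide_le_eq s_def t_def F_def G_def)
  qed
qed

lemma sum_split_diagonal:
  fixes f :: "'i \<Rightarrow> 'i \<Rightarrow> 'c::comm_monoid_add"
  assumes "finite I"
  shows "(\<Sum>i\<in>I. \<Sum>j\<in>I. f i j)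
    = (\<Sum>i\<in>I. f i i) + (\<Sum>(i, j) \<in> {(i, j). i \<in> I \<and> j \<in> I \<and> i \<noteq> j}. f i j)"
proof -
  have "{(i, j). i \<in> I \<and> j \<in> I \<and> i \<noteq> j} = (SIGMA i:I. I - {i})"
    by auto
  then have "(\<Sum>(i, j) \<in> {(i, j). i \<in> I \<and> j \<in> I \<and> i \<noteq> j}. f i j)
      = (\<Sum>i\<in>I. \<Sum>j\<in>I - {i}. f i j)"
    using assms by (simp add: sum.Sigma)
  moreover have "(\<Sum>j\<in>I. f i j) = f i i + (\<Sum>j\<in>I - {i}. f i j)" if "i \<in> I" for i
    using that assms by (simp add: sum.remove)
  ultimately show ?thesis
    by (simp add: sum.distrib)
qed

text \<open>
  The full double sum is \<open>(\<Sum> b\<^sub>i)\<^sup>2 \<le> card I * \<Sum> b\<^sub>i\<^sup>2\<close>; removing the diagonal lowers the factor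
  by one.
\<close>

lemma sum_off_diagonal_mult_le:
  fixes b :: "'i \<Rightarrow> real"
  assumes "finite I"
  shows "(\<Sum>(i, j) \<in> {(i, j). i \<in> I \<and> j \<in> I \<and> i \<noteq> j}. b i * b j)
    \<le> (real (card I) - 1) * (\<Sum>i\<in>I. (b i)\<^sup>2)"
proof -
  have "(\<Sum>i\<in>I. (b i)\<^sup>2) + (\<Sum>(i, j) \<in> {(i, j). i \<in> I \<and> j \<in> I \<and> i \<noteq> j}. b i * b j)
      = (\<Sum>i\<in>I. b i)\<^sup>2"
    using sum_split_diagonal[OF assms, of "\<lambda>i j. b i * b j"]
    by (simp add: power2_eq_square sum_product)
  also have "\<dots> \<le> real (card I) * (\<Sum>i\<in>I. (b i)\<^sup>2)"
    using sum_squared_le_sum_of_squares[of b I] assms by (simp add: mult.commute)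
  finally show ?thesis
    by (simp add: algebra_simps)
qed

lemma quadratic_sum_le:
  fixes a :: "'i \<Rightarrow> real" and h :: "'i \<Rightarrow> 'i \<Rightarrow> real"
  assumes fin: "finite I" "I \<noteq> {}" and pq: "p > 1" "q > 1" "1 / p + 1 / q = 1"
    and a: "\<And>i. i \<in> I \<Longrightarrow> a i \<ge> 0" and h: "\<And>i j. i \<in> I \<Longrightarrow> j \<in> I \<Longrightarrow> h i j \<ge> 0"
  shows "(\<Sum>i\<in>I. \<Sum>j\<in>I. a i * a j * h i j)
    \<le> (\<Sum>i\<in>I. a i powr (2 * p)) powr (1 / p)
      * ((\<Sum>i\<in>I. h i i powr q) powr (1 / q)
         + (real (card I) - 1) powr (1 / p)
           * (\<Sum>(i, j) \<in> {(i, j). i \<in> I \<and> j \<in> I \<and> i \<noteq> j}. h i j powr q) powr (1 / q))"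
proof -
  define D where "D = {(i, j). i \<in> I \<and> j \<in> I \<and> i \<noteq> j}"
  define A where "A = (\<Sum>i\<in>I. a i powr (2 * p))"
  define H where "H = (\<Sum>(i, j)\<in>D. h i j powr q) powr (1 / q)"
  have "D \<subseteq> I \<times> I"
    by (auto simp: D_def)
  then have finD: "finite D"
    using fin finite_subset by blast
  have A0: "A \<ge> 0"
    by (auto simp: A_def intro!: sum_nonneg)
  have card1: "real (card I) - 1 \<ge> 0"
    using fin by (simp add: Suc_le_eq card_gt_0_iff)
  have sq: "(a i * a i) powr p = a i powr (2 * p)" "(a i powr p)\<^sup>2 = a i powr (2 * p)"
    if "i \<in> I" for i
    using a[OF that] by (simp_all add: powr_mult power2_eq_square flip: powr_add)
  have "(\<Sum>i\<in>I. (a i * a i) * h i i)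
      \<le> (\<Sum>i\<in>I. (a i * a i) powr p) powr (1 / p) * (\<Sum>i\<in>I. h i i powr q) powr (1 / q)"
    using a h by (intro Holder_inequality_sum fin pq) auto
  then have diag: "(\<Sum>i\<in>I. (a i * a i) * h i i)
      \<le> A powr (1 / p) * (\<Sum>i\<in>I. h i i powr q) powr (1 / q)"
    by (simp add: A_def sq cong: sum.cong)
  have "(\<Sum>(i, j)\<in>D. (a i * a j) powr p) = (\<Sum>(i, j)\<in>D. a i powr p * a j powr p)"
    using a by (intro sum.cong) (auto simp: D_def powr_mult)
  also have "\<dots> \<le> (real (card I) - 1) * (\<Sum>i\<in>I. (a i powr p)\<^sup>2)"
    unfolding D_def by (rule sum_off_diagonal_mult_le[OF fin(1)])
  also have "\<dots> = (real (card I) - 1) * A"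
    by (simp add: A_def sq cong: sum.cong)
  finally have "(\<Sum>(i, j)\<in>D. (a i * a j) powr p) powr (1 / p)
      \<le> ((real (card I) - 1) * A) powr (1 / p)"
    using pq by (intro powr_mono2) (auto intro!: sum_nonneg)
  also have "\<dots> = (real (card I) - 1) powr (1 / p) * A powr (1 / p)"
    using card1 A0 by (simp add: powr_mult)
  finally have cross: "(\<Sum>(i, j)\<in>D. (a i * a j) powr p) powr (1 / p)
      \<le> (real (card I) - 1) powr (1 / p) * A powr (1 / p)" .
  have "(\<Sum>(i, j)\<in>D. a i * a j * h i j)
      \<le> (\<Sum>(i, j)\<in>D. (a i * a j) powr p) powr (1 / p) * H"
    using Holder_inequality_sum[OF finD pq, of "\<lambda>(i, j). a i * a j" "\<lambda>(i, j). h i j"] a h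
    by (auto simp: D_def H_def case_prod_unfold)
  also have "\<dots> \<le> ((real (card I) - 1) powr (1 / p) * A powr (1 / p)) * H"
    using cross by (intro mult_right_mono) (auto simp: H_def)
  finally have "(\<Sum>i\<in>I. \<Sum>j\<in>I. a i * a j * h i j)
      \<le> A powr (1 / p) * (\<Sum>i\<in>I. h i i powr q) powr (1 / q)
        + ((real (card I) - 1) powr (1 / p) * A powr (1 / p)) * H"
    using diag sum_split_diagonal[OF fin(1), of "\<lambda>i j. a i * a j * h i j"]
    by (simp add: D_def)
  then show ?thesis
    by (simp add: A_def H_def D_def algebra_simps)
qed

text \<open>
  The part of the argument common to both scalar fields: \<open>N\<close> and \<open>W\<close> stand for \<open>\<parallel>x\<parallel>\<close> and \<open>\<parallel>w\<parallel>\<close>,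
  and \<open>r i\<close> for \<open>\<parallel>y\<^sub>i\<parallel>\<close>.
\<close>

lemma Cauchy_Schwarz_imp_Holder_bound:
  fixes a r :: "nat \<Rightarrow> real" and h :: "nat \<Rightarrow> nat \<Rightarrow> real"
  assumes n: "n \<ge> 1" and p: "p > 1" and pq: "1 / p + 1 / q = 1"
    and a: "\<And>i. a i \<ge> 0" and h: "\<And>i j. h i j \<ge> 0"
    and r: "\<And>i. r i \<ge> 0" "\<And>i. h i i = (r i)\<^sup>2"
    and N: "N \<ge> 0" and le: "S \<le> N * W"
    and W: "W\<^sup>2 \<le> (\<Sum>i=1..n. \<Sum>j=1..n. a i * a j * h i j)"
  shows "S \<le> N * (\<Sum>i=1..n. a i powr (2 * p)) powr (1 / (2 * p))
    * ((\<Sum>i=1..n. r i powr (2 * q)) powr (1 / q)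
       + (real n - 1) powr (1 / p)
         * (\<Sum>(i, j) \<in> {(i, j). i \<in> {1..n} \<and> j \<in> {1..n} \<and> i \<noteq> j}. h i j powr q) powr (1 / q))
      powr (1 / 2)"
proof -
  define A where "A = (\<Sum>i=1..n. a i powr (2 * p))"
  define E where "E = (\<Sum>i=1..n. r i powr (2 * q)) powr (1 / q)
       + (real n - 1) powr (1 / p)
         * (\<Sum>(i, j) \<in> {(i, j). i \<in> {1..n} \<and> j \<in> {1..n} \<and> i \<noteq> j}. h i j powr q) powr (1 / q)"
  have "1 / p < 1"
    using p by simp
  with pq have "1 / q > 0"
    by linarith
  then have "q > 0"
    by simp
  moreover have "1 / q < 1"
    using pq p by (smt (verit) divide_pos_pos)
  ultimately have q: "q > 1"
    by simp
  have AE: "A \<ge> 0" "E \<ge> 0"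
    by (auto simp: A_def E_def intro!: sum_nonneg add_nonneg_nonneg)
  have hr: "h i i powr q = r i powr (2 * q)" for i
    using r(1)[of i] by (simp add: r(2) power2_eq_square powr_mult flip: powr_add)
  have "W\<^sup>2 \<le> A powr (1 / p) * E"
    using W quadratic_sum_le[of "{1..n}" p q a h] n p q pq a h by (simp add: A_def E_def hr)
  then have "W \<le> sqrt (A powr (1 / p) * E)"
    by (rule real_le_rsqrt)
  also have "\<dots> = A powr (1 / (2 * p)) * E powr (1 / 2)"
    using AE by (simp add: real_sqrt_mult powr_powr mult.commute[of 2 p] flip: powr_half_sqrt)
  finally have "N * W \<le> N * (A powr (1 / (2 * p)) * E powr (1 / 2))"
    using N by (rule mult_left_mono)
  then show ?thesis
    using le unfolding A_def E_def by (simp add: mult.assoc)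
qed

section \<open>Complex inner products\<close>

lemma cinner_zero_left: "cinner 0 (z :: 'b::complex_inner) = 0"
  using cinner_add_left[of 0 0 z] by simp

lemma cinner_sum_left:
  fixes z :: "'b::complex_inner"
  shows "cinner (\<Sum>i\<in>A. f i) z = (\<Sum>i\<in>A. cinner (f i) z)"
  by (induction A rule: infinite_finite_induct) (auto simp: cinner_add_left cinner_zero_left)

lemma cinner_sum_right:
  fixes z :: "'b::complex_inner"
  shows "cinner z (\<Sum>i\<in>A. f i) = (\<Sum>i\<in>A. cinner z (f i))"
  by (subst (1 2) cinner_commute) (simp add: cinner_sum_left)

lemma cinner_add_right: "cinner (z :: 'b::complex_inner) (x + y) = cinner z x + cinner z y"
  by (subst (1 2 3) cinner_commute) (simp add: cinner_add_left)

lemma cinner_scaleC_right: "cinner (x :: 'b::complex_inner) (scaleC a y) = cnj a * cinner x y"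
  by (subst (1 2) cinner_commute) (simp add: cinner_scaleC_left)

lemma cnorm_nonneg: "cnorm (x :: 'b::complex_inner) \<ge> 0"
  by (simp add: cnorm_def cinner_ge_zero)

lemma cinner_self: "cinner (x :: 'b::complex_inner) x = of_real ((cnorm x)\<^sup>2)"
proof -
  have "Im (cinner x x) = 0"
    using arg_cong[OF cinner_commute[of x x], of Im] by simp
  then show ?thesis
    by (simp add: complex_eq_iff cnorm_def cinner_ge_zero)
qed

text \<open>
  Up to the factor \<open>\<parallel>y\<parallel>\<^sup>2\<close>, the vector \<open>z\<close> in the proof is the component of \<open>x\<close> orthogonal to \<open>y\<close>;
  its squared norm is \<open>\<parallel>y\<parallel>\<^sup>2 (\<parallel>x\<parallel>\<^sup>2 \<parallel>y\<parallel>\<^sup>2 - |(x, y)|\<^sup>2)\<close>.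
\<close>

lemma complex_Cauchy_Schwarz:
  fixes x y :: "'b::complex_inner"
  shows "cmod (cinner x y) \<le> cnorm x * cnorm y"
proof (cases "y = 0")
  case True
  then have "cinner x y = 0"
    by (subst cinner_commute) (simp add: cinner_zero_left)
  then show ?thesis
    by (simp add: cnorm_nonneg)
next
  case False
  define c where "c = cinner x y"
  define b where "b = (cnorm y)\<^sup>2"
  define z where "z = scaleC (of_real b) x + scaleC (- c) y"
  have b: "cinner y y = of_real b"
    by (simp add: b_def cinner_self)
  with False have "b \<noteq> 0"
    using cinner_eq_zero_iff[of y] by auto
  then have bpos: "b > 0"
    by (simp add: b_def)
  have yx: "cinner y x = cnj c"
    unfolding c_def by (rule cinner_commute)
  have "cinner z z = of_real b * (of_real b * of_real ((cnorm x)\<^sup>2) - c * cnj c)"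
    unfolding z_def
    by (simp add: cinner_add_left cinner_add_right cinner_scaleC_left cinner_scaleC_right
        cinner_self[of x] b yx algebra_simps flip: c_def)
  also have "\<dots> = of_real (b * (b * (cnorm x)\<^sup>2 - (cmod c)\<^sup>2))"
    by (simp add: complex_norm_square[symmetric] del: of_real_power)
  finally have "0 \<le> b * (b * (cnorm x)\<^sup>2 - (cmod c)\<^sup>2)"
    using cinner_ge_zero[of z] by (metis Re_complex_of_real)
  then have "(cmod c)\<^sup>2 \<le> (cnorm x * cnorm y)\<^sup>2"
    using bpos by (simp add: zero_le_mult_iff b_def power_mult_distrib mult.commute)
  then show ?thesis
    unfolding c_def by (rule power2_le_imp_le) (simp add: cnorm_nonneg)
qed

section \<open>The generalised Bessel inequality\<close>

theorem mainTheorem5: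
  fixes p q :: real and n :: nat
    and x :: "'a::real_inner" and y :: "nat \<Rightarrow> 'a"
    and u :: "'b::complex_inner" and v :: "nat \<Rightarrow> 'b"
  assumes "n \<ge> 1" and "p > 1" and "1 / p + 1 / q = 1"
  shows
    "(\<Sum>i=1..n. \<bar>inner x (y i)\<bar>\<^sup>2)
        \<le> norm x * (\<Sum>i=1..n. \<bar>inner x (y i)\<bar> powr (2 * p)) powr (1 / (2 * p))
          * ((\<Sum>i=1..n. norm (y i) powr (2 * q)) powr (1 / q)
             + (real n - 1) powr (1 / p)
               * (\<Sum>(i, j) \<in> {(i, j). i \<in> {1..n} \<and> j \<in> {1..n} \<and> i \<noteq> j}.
                    \<bar>inner (y i) (y j)\<bar> powr q) powr (1 / q)) powr (1 / 2)
     \<and>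
     (\<Sum>i=1..n. (cmod (cinner u (v i)))\<^sup>2)
        \<le> cnorm u * (\<Sum>i=1..n. cmod (cinner u (v i)) powr (2 * p)) powr (1 / (2 * p))
          * ((\<Sum>i=1..n. cnorm (v i) powr (2 * q)) powr (1 / q)
             + (real n - 1) powr (1 / p)
               * (\<Sum>(i, j) \<in> {(i, j). i \<in> {1..n} \<and> j \<in> {1..n} \<and> i \<noteq> j}.
                    cmod (cinner (v i) (v j)) powr q) powr (1 / q)) powr (1 / 2)"
proof
  define w where "w = (\<Sum>i=1..n. inner x (y i) *\<^sub>R y i)"
  have "(\<Sum>i=1..n. \<bar>inner x (y i)\<bar>\<^sup>2) = inner x w"
    by (simp add: w_def inner_sum_right power2_eq_square)
  also have "\<dots> \<le> norm x * norm w"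
    by (rule norm_cauchy_schwarz)
  finally have le: "(\<Sum>i=1..n. \<bar>inner x (y i)\<bar>\<^sup>2) \<le> norm x * norm w" .
  have "(norm w)\<^sup>2 = (\<Sum>i=1..n. \<Sum>j=1..n. inner x (y i) * inner x (y j) * inner (y i) (y j))"
    unfolding power2_norm_eq_inner
    by (simp add: w_def inner_sum_left inner_sum_right sum_distrib_left mult_ac inner_commute)
  also have "\<dots> \<le> (\<Sum>i=1..n. \<Sum>j=1..n.
      \<bar>inner x (y i)\<bar> * \<bar>inner x (y j)\<bar> * \<bar>inner (y i) (y j)\<bar>)"
    by (intro sum_mono) (simp flip: abs_mult)
  finally show "(\<Sum>i=1..n. \<bar>inner x (y i)\<bar>\<^sup>2)
        \<le> norm x * (\<Sum>i=1..n. \<bar>inner x (y i)\<bar> powr (2 * p)) powr (1 / (2 * p))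
          * ((\<Sum>i=1..n. norm (y i) powr (2 * q)) powr (1 / q)
             + (real n - 1) powr (1 / p)
               * (\<Sum>(i, j) \<in> {(i, j). i \<in> {1..n} \<and> j \<in> {1..n} \<and> i \<noteq> j}.
                    \<bar>inner (y i) (y j)\<bar> powr q) powr (1 / q)) powr (1 / 2)"
    by (intro Cauchy_Schwarz_imp_Holder_bound[OF assms, where W = "norm w"] le)
      (auto simp: power2_norm_eq_inner)
next
  define w where "w = (\<Sum>i=1..n. scaleC (cinner u (v i)) (v i))"
  have "cinner u w = of_real (\<Sum>i=1..n. (cmod (cinner u (v i)))\<^sup>2)"
    by (simp add: w_def cinner_sum_right cinner_scaleC_right complex_norm_square mult.commute
        del: of_real_power)
  then have "(\<Sum>i=1..n. (cmod (cinner u (v i)))\<^sup>2) = cmod (cinner u w)"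
    by (simp add: sum_nonneg del: of_real_sum)
  also have "\<dots> \<le> cnorm u * cnorm w"
    by (rule complex_Cauchy_Schwarz)
  finally have le: "(\<Sum>i=1..n. (cmod (cinner u (v i)))\<^sup>2) \<le> cnorm u * cnorm w" .
  have "(cnorm w)\<^sup>2 = cmod (cinner w w)"
    by (simp add: cinner_self norm_power)
  also have "cinner w w = (\<Sum>i=1..n. \<Sum>j=1..n.
      cinner u (v i) * cnj (cinner u (v j)) * cinner (v i) (v j))"
    by (subst w_def, subst cinner_sum_left)
      (simp add: w_def cinner_sum_right cinner_scaleC_left cinner_scaleC_right
        sum_distrib_left mult_ac)
  also have "cmod \<dots> \<le> (\<Sum>i=1..n. \<Sum>j=1..n.
      cmod (cinner u (v i)) * cmod (cinner u (v j)) * cmod (cinner (v i) (v j)))"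
    by (intro sum_norm_le) (simp add: norm_mult)
  finally show "(\<Sum>i=1..n. (cmod (cinner u (v i)))\<^sup>2)
        \<le> cnorm u * (\<Sum>i=1..n. cmod (cinner u (v i)) powr (2 * p)) powr (1 / (2 * p))
          * ((\<Sum>i=1..n. cnorm (v i) powr (2 * q)) powr (1 / q)
             + (real n - 1) powr (1 / p)
               * (\<Sum>(i, j) \<in> {(i, j). i \<in> {1..n} \<and> j \<in> {1..n} \<and> i \<noteq> j}.
                    cmod (cinner (v i) (v j)) powr q) powr (1 / q)) powr (1 / 2)"
    by (intro Cauchy_Schwarz_imp_Holder_bound[OF assms, where W = "cnorm w"] le)
      (auto simp: cnorm_nonneg cinner_self norm_power)
qed

end
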